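(* There exists an absolute constant $c>0$ such that for every positive integer $n$ and every non-constant function $f\colon\{0,1\}^n\to\{0,1\}$, $$\mathbb{E}_{x}\left[\sqrt{s_f(x)}\right]\;\geq\; c\cdot \mathrm{var}(f)\sqrt{\log\left(\frac{1}{\mathrm{var}(f)}\right)}.$$
   Context: Here $x$ is uniformly distributed over $\{0,1\}^n$, $\log$ denotes the base-$2$ logarithm, and $\mathrm{var}(f)=\mathbb{E}_x[f(x)^2]-\mathbb{E}_x[f(x)]^2$ is the variance of $f(x)$. The sensitivity $s_f(x)$ of $f$ at $x$ is the number of coordinates $i\in[n]=\{1,\dots,n\}$ such that $f(x\oplus e_i)\neq f(x)$, where $x\oplus e_i$ is $x$ with its $i$th bit flipped. *)

theory Defs
  imports "HOL-Probability.Probability"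
begin

text \<open>
  Points of \<open>{0,1}^n\<close> are extensional functions on \<open>{1..n}\<close>, with 0 and 1 encoded as the
  Booleans \<open>False\<close> and \<open>True\<close>.  The dimension is a term rather than a type, so that a
  constant can be chosen uniformly in it.
\<close>

definition cube :: "nat \<Rightarrow> (nat \<Rightarrow> bool) set" where
  "cube n = (\<Pi>\<^sub>E i\<in>{1..n}. UNIV)"

lemma finite_cube [simp]: "finite (cube n)"
  by (simp add: cube_def finite_PiE)

lemma cube_nonempty [simp]: "cube n \<noteq> {}"
  by (simp add: cube_def PiE_eq_empty_iff)

definition flip :: "nat \<Rightarrow> (nat \<Rightarrow> bool) \<Rightarrow> (nat \<Rightarrow> bool)" where
  "flip i x = x(i := \<not> x i)"

lemma flip_in_cube: "x \<in> cube n \<Longrightarrow> i \<in> {1..n} \<Longrightarrow> flip i x \<in> cube n"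
  by (auto simp: cube_def flip_def PiE_iff extensional_def)

definition sensitivity :: "nat \<Rightarrow> ((nat \<Rightarrow> bool) \<Rightarrow> bool) \<Rightarrow> (nat \<Rightarrow> bool) \<Rightarrow> nat" where
  "sensitivity n f x = card {i \<in> {1..n}. f (flip i x) \<noteq> f x}"

definition cube_expectation :: "nat \<Rightarrow> ((nat \<Rightarrow> bool) \<Rightarrow> real) \<Rightarrow> real" where
  "cube_expectation n g = measure_pmf.expectation (pmf_of_set (cube n)) g"

definition cube_variance :: "nat \<Rightarrow> ((nat \<Rightarrow> bool) \<Rightarrow> bool) \<Rightarrow> real" where
  "cube_variance n f =
     cube_expectation n (\<lambda>x. (of_bool (f x))\<^sup>2) - (cube_expectation n (\<lambda>x. of_bool (f x)))\<^sup>2"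

end

theory Submission
  imports Defs "HOL-Real_Asymp.Real_Asymp"
begin

text \<open>
  The proof is Bobkov's induction on the dimension. Suppose \<open>J\<close> on \<open>[0,1]\<close> vanishes at the
  endpoints and satisfies the two-point inequality
  \<open>2 J((a+b)/2) \<le> sqrt (J(a)^2 + (a-b)^2) + sqrt (J(b)^2 + (a-b)^2)\<close>. Splitting the cube along the
  last coordinate, Minkowski's inequality in the plane and the two-point inequality give
  \<open>E sqrt(s_f) \<ge> J(E f)\<close>. Instead of the Gaussian isoperimetric profile we use the explicit function
  \<open>J(y) = v * sqrt (2 - ln v)\<close> with \<open>v = y * (1 - y)\<close>; at \<open>y = E f\<close> the number \<open>v\<close> is the variance
  of \<open>f\<close>. The two-point inequality holds because \<open>G = J^2\<close> satisfies
  \<open>G'^2 \<le> 2 * G * (G'' + 8)\<close> and \<open>G''\<close> is a convex decreasing function of \<open>v\<close>.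
\<close>

section \<open>The squared profile, its continuity and its derivatives\<close>

definition profile_var :: "real \<Rightarrow> real" where
  "profile_var v = v\<^sup>2 * (2 - ln v)"

definition profile_sq :: "real \<Rightarrow> real" where
  "profile_sq y = profile_var (y * (1 - y))"

definition profile_sq' :: "real \<Rightarrow> real" where
  "profile_sq' y = (let v = y * (1 - y) in v * (3 - 2 * ln v) * (1 - 2 * y))"

text \<open>This is the second derivative of \<open>profile_sq\<close> at \<open>y\<close>, written
  in \<open>v = y * (1 - y)\<close>. It depends on \<open>v\<close> alone because the squared slope
  of \<open>v\<close> in \<open>y\<close> is \<open>1 - 4 * v\<close>.\<close>

definition curvature :: "real \<Rightarrow> real" where
  "curvature v = 1 - 10 * v - 2 * ln v + 12 * v * ln v"

lemma bernoulli_var_le: "y * (1 - y) \<le> 1 / 4" for y :: real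
  using zero_le_power2[of "2 * y - 1"] by (simp add: power2_eq_square algebra_simps)

lemma ln_quarter_le: "0 < v \<Longrightarrow> v \<le> 1 / 4 \<Longrightarrow> ln v \<le> - 3 / 4" for v :: real
  using ln_le_minus_one[of v] by linarith

text \<open>At 0 the point is that \<open>v\<^sup>2 * ln v\<close> tends to 0. Continuity up to 0
  lets derivative arguments on open intervals reach the endpoints \<open>y = 0\<close> and
  \<open>y = 1\<close>.\<close>

lemma continuous_on_profile_var: "continuous_on {0..} profile_var"
proof (unfold continuous_on_eq_continuous_within, intro ballI)
  fix v :: real
  assume v: "v \<in> {0..}"
  show "continuous (at v within {0..}) profile_var"
  proof (cases "v = 0")
    case True
    have "((\<lambda>v::real. v\<^sup>2 * (2 - ln v)) \<longlongrightarrow> 0) (at_right 0)"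
      by real_asymp
    then show ?thesis
      unfolding continuous_within True at_within_Ici_at_right by (simp add: profile_var_def[abs_def])
  next
    case False
    with v have "isCont profile_var v"
      unfolding profile_var_def by (intro continuous_intros) auto
    then show ?thesis
      by (rule continuous_at_imp_continuous_at_within)
  qed
qed

lemma continuous_on_profile_sq: "continuous_on {0..1} profile_sq"
  unfolding profile_sq_def
  by (rule continuous_on_compose2[OF continuous_on_profile_var]) (auto intro!: continuous_intros)

lemma profile_var_mono:
  assumes "0 \<le> u" "u \<le> v" "v \<le> 1 / 4"
  shows "profile_var u \<le> profile_var v"
proof (rule DERIV_nonneg_imp_increasing_open[OF assms(2)])
  fix x assume x: "u < x" "x < v"
  have "(profile_var has_real_derivative x * (3 - 2 * ln x)) (at x)"
    unfolding profile_var_def using x assms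
    by (auto intro!: derivative_eq_intros simp: power2_eq_square field_simps)
  moreover have "0 \<le> x * (3 - 2 * ln x)"
    using ln_quarter_le[of x] x assms by (intro mult_nonneg_nonneg) auto
  ultimately show "\<exists>d. (profile_var has_real_derivative d) (at x) \<and> 0 \<le> d"
    by blast
next
  show "continuous_on {u..v} profile_var"
    using continuous_on_profile_var by (rule continuous_on_subset) (use assms in auto)
qed

lemma profile_sq_nonneg: "0 \<le> y \<Longrightarrow> y \<le> 1 \<Longrightarrow> 0 \<le> profile_sq y"
  using profile_var_mono[of 0 "y * (1 - y)"] bernoulli_var_le[of y]
  by (simp add: profile_sq_def profile_var_def)

lemma profile_sq_reflect: "profile_sq (1 - y) = profile_sq y"
  by (simp add: profile_sq_def mult.commute)

lemma profile_sq_deriv: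
  assumes "0 < y" "y < 1"
  shows "(profile_sq has_real_derivative profile_sq' y) (at y)"
proof -
  have "0 < y * (1 - y)" using assms by simp
  then show ?thesis
    unfolding profile_sq_def profile_var_def profile_sq'_def Let_def
    by (auto intro!: derivative_eq_intros simp: power2_eq_square) (use assms in \<open>simp add: field_simps\<close>)
qed

lemma profile_sq_deriv2:
  assumes "0 < y" "y < 1"
  shows "(profile_sq' has_real_derivative curvature (y * (1 - y))) (at y)"
proof -
  have "0 < y * (1 - y)" using assms by simp
  then show ?thesis
    unfolding profile_sq'_def curvature_def Let_def
    by (auto intro!: derivative_eq_intros) (use assms in \<open>simp add: field_simps\<close>)
qed

section \<open>Shape of the second derivative and the differential inequality\<close>

text \<open>For \<open>x \<le> 1 / 4\<close> both \<open>2 - 2 / x\<close> and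
  \<open>12 * ln x\<close> are nonpositive. Since \<open>y * (1 - y)\<close> falls away from 1/2,
  the second derivative of \<open>profile_sq\<close> grows away from the centre.\<close>

lemma curvature_antimono:
  assumes "0 < u" "u \<le> v" "v \<le> 1 / 4"
  shows "curvature v \<le> curvature u"
proof (rule DERIV_nonpos_imp_nonincreasing[OF assms(2)])
  fix x assume x: "u \<le> x" "x \<le> v"
  have "(curvature has_real_derivative 2 - 2 / x + 12 * ln x) (at x)"
    unfolding curvature_def using x assms
    by (auto intro!: derivative_eq_intros simp: field_simps)
  moreover have "2 - 2 / x + 12 * ln x \<le> 0"
  proof -
    have "2 \<le> 2 / x" using x assms by (simp add: field_simps)
    then show ?thesis using ln_quarter_le[of x] x assms by auto
  qed
  ultimately show "\<exists>d. (curvature has_real_derivative d) (at x) \<and> d \<le> 0"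
    by blast
qed

lemma curvature_convex: "convex_on {0<..} curvature"
proof (rule f''_ge0_imp_convex)
  fix x :: real
  assume x: "x \<in> {0<..}"
  show "(curvature has_real_derivative 2 - 2 / x + 12 * ln x) (at x)"
    unfolding curvature_def using x
    by (auto intro!: derivative_eq_intros simp: field_simps)
  show "((\<lambda>x. 2 - 2 / x + 12 * ln x) has_real_derivative 2 / x\<^sup>2 + 12 / x) (at x)"
    using x by (auto intro!: derivative_eq_intros simp: field_simps power2_eq_square)
  show "0 \<le> 2 / x\<^sup>2 + 12 / x"
    using x by simp
qed simp

text \<open>Moving symmetrically away from \<open>c\<close> lowers the mean of
  \<open>y * (1 - y)\<close> by \<open>t\<^sup>2\<close>. Monotonicity turns this into larger
  curvature at the mean, and convexity bounds that by the mean of the curvatures.\<close>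

lemma curvature_midpoint:
  assumes "0 < c - t" "c + t < 1" "0 \<le> t"
  shows "2 * curvature (c * (1 - c))
    \<le> curvature ((c + t) * (1 - (c + t))) + curvature ((c - t) * (1 - (c - t)))"
proof -
  let ?u = "(c + t) * (1 - (c + t))" and ?w = "(c - t) * (1 - (c - t))"
  have pos: "0 < ?u" "0 < ?w" using assms by simp_all
  have mid: "(1/2) * ?u + (1/2) * ?w = c * (1 - c) - t\<^sup>2"
    by (simp add: power2_eq_square field_simps)
  have "curvature (c * (1 - c)) \<le> curvature ((1/2) * ?u + (1/2) * ?w)"
  proof (rule curvature_antimono)
    show "0 < (1/2) * ?u + (1/2) * ?w" using pos by linarith
    show "(1/2) * ?u + (1/2) * ?w \<le> c * (1 - c)" by (simp only: mid) simp
  qed (rule bernoulli_var_le)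
  also have "\<dots> \<le> (1/2) * curvature ?u + (1/2) * curvature ?w"
    using convex_onD[OF curvature_convex, of "1/2" ?u ?w] pos by simp
  finally show ?thesis by simp
qed

text \<open>In terms of \<open>v\<close> and \<open>L = 2 - ln v\<close> the difference of the two
  sides is \<open>v\<^sup>2\<close> times a polynomial in \<open>v\<close> and \<open>L\<close>,
  which is nonnegative because \<open>v * L\<close> is bounded. The constant 8 is what the two terms
  \<open>4 * x\<^sup>2\<close> in \<open>two_point_centered\<close> supply.\<close>

lemma profile_sq_ode:
  assumes "0 < y" "y < 1"
  shows "(profile_sq' y)\<^sup>2 \<le> 2 * profile_sq y * (curvature (y * (1 - y)) + 8)"
proof -
  define v where "v = y * (1 - y)"
  define L where "L = 2 - ln v"
  have v: "0 < v" "v \<le> 1 / 4"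
    using assms bernoulli_var_le[of y] by (auto simp: v_def)
  have L: "2 \<le> L" using ln_quarter_le[of v] v by (simp add: L_def)
  \<comment> \<open>This gives \<open>L = 2 + ln (1 / v) \<le> 1 + 1 / v\<close>, hence
    \<open>v * L \<le> v + 1 \<le> 5 / 4\<close>.\<close>
  have "ln (1 / v) \<le> 1 / v - 1" using v by (intro ln_le_minus_one) simp
  then have "v * L \<le> v * (1 + 1 / v)"
    using v by (intro mult_left_mono) (auto simp: L_def ln_div)
  then have vL: "v * L \<le> 5 / 4" using v by (simp add: distrib_left)
  have "v * L * L \<le> 5 / 4 * L" using vL L by (intro mult_right_mono) auto
  moreover have "0 \<le> v * L" using v L by simp
  \<comment> \<open>The term \<open>8 * (v * L * L)\<close> is at most \<open>10 * L\<close>, so at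
    least \<open>4 * L - 1\<close> remains.\<close>
  ultimately have "0 \<le> 14 * L - 1 - 8 * (v * L * L) + 12 * (v * L) + 4 * v"
    using v L by linarith
  then have "0 \<le> v\<^sup>2 * (14 * L - 1 - 8 * (v * L * L) + 12 * (v * L) + 4 * v)"
    by simp
  also have "\<dots> = 2 * profile_sq y * (curvature v + 8) - (v * (2 * L - 1))\<^sup>2 * (1 - 4 * v)"
    unfolding profile_sq_def profile_var_def curvature_def v_def[symmetric]
    by (simp add: L_def algebra_simps power2_eq_square)
  also have "(v * (2 * L - 1))\<^sup>2 * (1 - 4 * v) = (profile_sq' y)\<^sup>2"
  proof -
    have "1 - 4 * v = (1 - 2 * y)\<^sup>2" by (simp add: v_def power2_eq_square algebra_simps)
    moreover have "profile_sq' y = v * (2 * L - 1) * (1 - 2 * y)"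
      by (simp add: profile_sq'_def Let_def v_def L_def)
    ultimately show ?thesis
      by (simp only: power_mult_distrib)
  qed
  finally show ?thesis by (simp add: v_def)
qed

section \<open>Symmetric differences of the squared profile\<close>

text \<open>After subtracting the quadratic term, \<open>D\<close> has slope 0 at 0 and, by
  \<open>curvature_midpoint\<close>, a nonnegative second derivative, so it is
  nondecreasing.\<close>

lemma profile_sq_second_difference:
  assumes "0 < x" "x \<le> c" "c + x \<le> 1"
  shows "curvature (c * (1 - c)) * x\<^sup>2 \<le> profile_sq (c + x) + profile_sq (c - x) - 2 * profile_sq c"
proof -
  define k where "k = curvature (c * (1 - c))"
  define D where "D t = profile_sq (c + t) + profile_sq (c - t) - k * t\<^sup>2" for t
  define D' where "D' t = profile_sq' (c + t) - profile_sq' (c - t) - 2 * k * t" for t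
  have D': "0 \<le> D' t" if t: "0 \<le> t" "t < x" for t
  proof -
    have "D' 0 \<le> D' t"
    proof (rule DERIV_nonneg_imp_nondecreasing[OF t(1)])
      fix s assume s: "0 \<le> s" "s \<le> t"
      have "(D' has_real_derivative curvature ((c + s) * (1 - (c + s)))
          + curvature ((c - s) * (1 - (c - s))) - 2 * k) (at s)"
        unfolding D'_def using s t assms
        by (auto intro!: derivative_eq_intros DERIV_chain2[OF profile_sq_deriv2])
      moreover have "0 \<le> curvature ((c + s) * (1 - (c + s)))
          + curvature ((c - s) * (1 - (c - s))) - 2 * k"
        using curvature_midpoint[of c s] s t assms by (simp add: k_def)
      ultimately show "\<exists>d. (D' has_real_derivative d) (at s) \<and> 0 \<le> d" by blast
    qed
    then show ?thesis by (simp add: D'_def)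
  qed
  have "D 0 \<le> D x"
  \<comment> \<open>The derivative is taken only for \<open>t < x\<close>: at \<open>t = x\<close>
    the point \<open>c - t\<close> may be 0 or \<open>c + t\<close> may be 1, where
    \<open>profile_sq_deriv\<close> does not apply.\<close>
  proof (rule DERIV_nonneg_imp_increasing_open[where f = D])
    fix t assume t: "0 < t" "t < x"
    have "(D has_real_derivative D' t) (at t)"
      unfolding D_def D'_def using t assms
      by (auto intro!: derivative_eq_intros DERIV_chain2[OF profile_sq_deriv])
    with D'[of t] t show "\<exists>d. (D has_real_derivative d) (at t) \<and> 0 \<le> d" by auto
  next
    show "continuous_on {0..x} D"
      unfolding D_def using assms
      by (auto intro!: continuous_intros continuous_on_compose2[OF continuous_on_profile_sq])
  qed (use assms in simp)
  then show ?thesis by (simp add: D_def k_def)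
qed

text \<open>As \<open>c \<le> 1 / 2\<close>, the point \<open>c - t\<close> is at least as far from
  1/2 as \<open>c + t\<close>, so the second derivative is at least as large there. Hence
  \<open>profile_sq' (c + t) + profile_sq' (c - t)\<close> is largest at \<open>t = 0\<close>, and
  integration in \<open>t\<close> gives the bound.\<close>

lemma profile_sq_first_difference:
  assumes "0 < x" "x \<le> c" "c \<le> 1 / 2"
  shows "\<bar>profile_sq (c + x) - profile_sq (c - x)\<bar> \<le> 2 * x * profile_sq' c"
proof -
  define D where "D t = 2 * t * profile_sq' c - (profile_sq (c + t) - profile_sq (c - t))" for t
  define D' where "D' t = 2 * profile_sq' c - profile_sq' (c + t) - profile_sq' (c - t)" for t
  have order: "(c - s) * (1 - (c - s)) \<le> (c + s) * (1 - (c + s))" if "0 \<le> s" for s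
    using mult_nonneg_nonneg[of s "1 - 2 * c"] that assms by (simp add: algebra_simps)
  have D': "0 \<le> D' t" if t: "0 \<le> t" "t < x" for t
  proof -
    have "D' 0 \<le> D' t"
    proof (rule DERIV_nonneg_imp_nondecreasing[OF t(1)])
      fix s assume s: "0 \<le> s" "s \<le> t"
      have "(D' has_real_derivative curvature ((c - s) * (1 - (c - s)))
          - curvature ((c + s) * (1 - (c + s)))) (at s)"
        unfolding D'_def using s t assms
        by (auto intro!: derivative_eq_intros DERIV_chain2[OF profile_sq_deriv2])
      moreover have "0 \<le> curvature ((c - s) * (1 - (c - s))) - curvature ((c + s) * (1 - (c + s)))"
        using curvature_antimono[OF _ order[OF s(1)] bernoulli_var_le] s t assms by simp
      ultimately show "\<exists>d. (D' has_real_derivative d) (at s) \<and> 0 \<le> d" by blast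
    qed
    then show ?thesis by (simp add: D'_def)
  qed
  have "D 0 \<le> D x"
  proof (rule DERIV_nonneg_imp_increasing_open[where f = D])
    fix t assume t: "0 < t" "t < x"
    have "(D has_real_derivative D' t) (at t)"
      unfolding D_def D'_def using t assms
      by (auto intro!: derivative_eq_intros DERIV_chain2[OF profile_sq_deriv])
    with D'[of t] t show "\<exists>d. (D has_real_derivative d) (at t) \<and> 0 \<le> d" by auto
  next
    show "continuous_on {0..x} D"
      unfolding D_def using assms
      by (auto intro!: continuous_intros continuous_on_compose2[OF continuous_on_profile_sq])
  qed (use assms in simp)
  \<comment> \<open>This fixes the sign of the difference and removes the absolute value.\<close>
  moreover have "profile_sq (c - x) \<le> profile_sq (c + x)"
    unfolding profile_sq_def
    using order[of x] assms bernoulli_var_le[of "c + x"] by (intro profile_var_mono) auto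
  ultimately show ?thesis by (simp add: D_def)
qed

section \<open>The two-point inequality\<close>

text \<open>With \<open>S\<close> and \<open>D\<close> the sum and difference of the two roots,
  \<open>disc\<close> says that \<open>(4 * u - S\<^sup>2) * (4 * u - D\<^sup>2)\<close> is at most
  0. As \<open>D\<^sup>2 \<le> S\<^sup>2\<close>, having \<open>S\<^sup>2 < 4 * u\<close> would make
  both factors positive.\<close>

lemma sqrt_add_sqrt_ge:
  fixes A B u :: real
  assumes "0 \<le> A" "0 \<le> B" "0 \<le> u" and disc: "16 * u\<^sup>2 + (A - B)\<^sup>2 \<le> 8 * u * (A + B)"
  shows "2 * sqrt u \<le> sqrt A + sqrt B"
proof (rule ccontr)
  define S D where "S = sqrt A + sqrt B" and "D = sqrt A - sqrt B"
  assume "\<not> 2 * sqrt u \<le> sqrt A + sqrt B"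
  moreover have "0 \<le> S" using assms by (simp add: S_def)
  ultimately have "S\<^sup>2 < (2 * sqrt u)\<^sup>2"
    by (intro power_strict_mono) (auto simp: S_def)
  then have S: "S\<^sup>2 < 4 * u" using assms by (simp add: power_mult_distrib)
  have "\<bar>D\<bar> \<le> \<bar>S\<bar>"
    using real_sqrt_ge_zero[OF assms(1)] real_sqrt_ge_zero[OF assms(2)]
    unfolding S_def D_def by linarith
  then have "D\<^sup>2 \<le> S\<^sup>2" by (simp add: abs_le_square_iff)
  with S have "0 < (4 * u - S\<^sup>2) * (4 * u - D\<^sup>2)" by simp
  also have "\<dots> = 16 * u\<^sup>2 + (S * D)\<^sup>2 - 4 * u * (S\<^sup>2 + D\<^sup>2)"
    by (simp add: power2_eq_square algebra_simps)
  also have "S * D = A - B"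
    using assms by (simp add: S_def D_def algebra_simps)
  also have "S\<^sup>2 + D\<^sup>2 = 2 * (A + B)"
    using assms by (simp add: S_def D_def power2_sum power2_diff)
  finally show False using disc by (simp add: algebra_simps)
qed

text \<open>The bounds on the first and second differences, linked by \<open>profile_sq_ode\<close>,
  combine to the hypothesis \<open>disc\<close> of \<open>sqrt_add_sqrt_ge\<close> with
  \<open>u = profile_sq c\<close>.\<close>

lemma two_point_centered:
  assumes "0 \<le> x" "x \<le> c" "c \<le> 1 / 2"
  shows "2 * sqrt (profile_sq c)
    \<le> sqrt (profile_sq (c + x) + 4 * x\<^sup>2) + sqrt (profile_sq (c - x) + 4 * x\<^sup>2)"
proof (cases "x = 0")
  case False
  then have x: "0 < x" using assms by simp
  let ?A = "profile_sq (c + x) + 4 * x\<^sup>2" and ?B = "profile_sq (c - x) + 4 * x\<^sup>2"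
  let ?k = "curvature (c * (1 - c))"
  have nonneg: "0 \<le> profile_sq (c + x)" "0 \<le> profile_sq (c - x)" "0 \<le> profile_sq c"
    using assms by (auto intro!: profile_sq_nonneg)
  have "(?A - ?B)\<^sup>2 \<le> (2 * x * profile_sq' c)\<^sup>2"
    using profile_sq_first_difference[OF x assms(2,3)] by (simp add: abs_le_square_iff[symmetric])
  also have "\<dots> = 4 * x\<^sup>2 * (profile_sq' c)\<^sup>2"
    by (simp add: power_mult_distrib)
  also have "\<dots> \<le> 4 * x\<^sup>2 * (2 * profile_sq c * (?k + 8))"
    using assms x by (intro mult_left_mono profile_sq_ode) auto
  also have "\<dots> = 8 * profile_sq c * (?k * x\<^sup>2 + 8 * x\<^sup>2)"
    by (simp add: algebra_simps)
  \<comment> \<open>Here \<open>8 * x\<^sup>2\<close> is exactly the sum of the terms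
    \<open>4 * x\<^sup>2\<close> in \<open>?A\<close> and \<open>?B\<close>.\<close>
  also have "\<dots> \<le> 8 * profile_sq c * (?A + ?B - 2 * profile_sq c)"
    using profile_sq_second_difference[OF x assms(2)] assms nonneg
    by (intro mult_left_mono) auto
  finally have "16 * (profile_sq c)\<^sup>2 + (?A - ?B)\<^sup>2 \<le> 8 * profile_sq c * (?A + ?B)"
    by (simp add: algebra_simps power2_eq_square)
  then show ?thesis
    using nonneg by (intro sqrt_add_sqrt_ge) auto
qed simp

text \<open>Swapping \<open>a\<close> and \<open>b\<close> and reflecting \<open>y\<close> to
  \<open>1 - y\<close> preserve the inequality, which reduces it to \<open>a \<le> b\<close> and
  \<open>a + b \<le> 1\<close>. There the midpoint and the half-distance satisfy the hypotheses of
  \<open>two_point_centered\<close>.\<close>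

lemma two_point:
  assumes "0 \<le> a" "a \<le> 1" "0 \<le> b" "b \<le> 1"
  shows "2 * sqrt (profile_sq ((a + b) / 2))
    \<le> sqrt (profile_sq a + (a - b)\<^sup>2) + sqrt (profile_sq b + (a - b)\<^sup>2)"
proof -
  have ordered: "2 * sqrt (profile_sq ((a + b) / 2))
      \<le> sqrt (profile_sq a + (a - b)\<^sup>2) + sqrt (profile_sq b + (a - b)\<^sup>2)"
    if "0 \<le> a" "a \<le> b" "a + b \<le> 1" for a b
  proof -
    have eqs: "(a + b) / 2 + (b - a) / 2 = b" "(a + b) / 2 - (b - a) / 2 = a"
      "4 * ((b - a) / 2)\<^sup>2 = (a - b)\<^sup>2"
      by (simp_all add: field_simps power2_eq_square)
    show ?thesis
      using two_point_centered[of "(b - a) / 2" "(a + b) / 2", unfolded eqs] that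
      by (simp add: add.commute[of "sqrt (profile_sq a + _)"])
  qed
  have low: "2 * sqrt (profile_sq ((a + b) / 2))
      \<le> sqrt (profile_sq a + (a - b)\<^sup>2) + sqrt (profile_sq b + (a - b)\<^sup>2)"
    if "0 \<le> a" "0 \<le> b" "a + b \<le> 1" for a b
    using ordered[of a b] ordered[of b a] that
    by (cases "a \<le> b") (auto simp: add.commute power2_commute)
  show ?thesis
  proof (cases "a + b \<le> 1")
    case False
    have eqs: "((1 - a) + (1 - b)) / 2 = 1 - (a + b) / 2" "((1 - a) - (1 - b))\<^sup>2 = (a - b)\<^sup>2"
      by (simp_all add: field_simps power2_eq_square)
    show ?thesis
      using low[of "1 - a" "1 - b", unfolded eqs profile_sq_reflect] False assms by simp
  qed (use low assms in simp)
qed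

section \<open>Splitting the cube along its last coordinate\<close>

lemma card_cube: "card (cube n) = 2 ^ n"
  by (simp add: cube_def card_PiE)

lemma cube_expectation_eq_sum: "cube_expectation n g = (\<Sum>x\<in>cube n. g x) / 2 ^ n"
  by (simp add: cube_expectation_def integral_pmf_of_set card_cube)

text \<open>Points of \<open>cube n\<close> are \<open>undefined\<close> at \<open>Suc n\<close>, so
  setting that coordinate is a bijection from pairs \<open>(b, x)\<close> onto
  \<open>cube (Suc n)\<close>.\<close>

lemma cube_expectation_Suc:
  "cube_expectation (Suc n) g =
    (cube_expectation n (\<lambda>x. g (x(Suc n := True))) + cube_expectation n (\<lambda>x. g (x(Suc n := False)))) / 2"
proof -
  have "cube (Suc n) = (\<lambda>(b, x). x(Suc n := b)) ` (UNIV \<times> cube n)"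
    unfolding cube_def by (simp add: atLeastAtMostSuc_conv PiE_insert_eq)
  moreover have "inj_on (\<lambda>(b, x). x(Suc n := b)) (UNIV \<times> cube n)"
    unfolding cube_def by (rule inj_combinator) simp
  ultimately have "(\<Sum>x\<in>cube (Suc n). g x) = (\<Sum>(b, x)\<in>UNIV \<times> cube n. g (x(Suc n := b)))"
    by (simp add: sum.reindex case_prod_unfold)
  also have "\<dots> = (\<Sum>x\<in>cube n. g (x(Suc n := True))) + (\<Sum>x\<in>cube n. g (x(Suc n := False)))"
    by (simp add: sum.cartesian_product[symmetric] UNIV_bool)
  finally show ?thesis
    by (simp add: cube_expectation_eq_sum add_divide_distrib)
qed

lemma cube_expectation_mono:
  "(\<And>x. g x \<le> h x) \<Longrightarrow> cube_expectation n g \<le> cube_expectation n h"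
  by (auto simp: cube_expectation_eq_sum intro!: divide_right_mono sum_mono)

lemma cube_expectation_of_bool_bounds:
  "0 \<le> cube_expectation n (\<lambda>x. of_bool (f x))" "cube_expectation n (\<lambda>x. of_bool (f x)) \<le> 1"
proof -
  show "0 \<le> cube_expectation n (\<lambda>x. of_bool (f x))"
    by (simp add: cube_expectation_eq_sum sum_nonneg)
  have "cube_expectation n (\<lambda>x. of_bool (f x)) \<le> cube_expectation n (\<lambda>x. 1)"
    by (rule cube_expectation_mono) simp
  then show "cube_expectation n (\<lambda>x. of_bool (f x)) \<le> 1"
    by (simp add: cube_expectation_eq_sum card_cube)
qed

text \<open>This is the triangle inequality for a sum of complex numbers with real parts
  \<open>g x\<close> and imaginary parts \<open>h x\<close>.\<close>

lemma cube_expectation_minkowski: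
  "sqrt ((cube_expectation n g)\<^sup>2 + (cube_expectation n h)\<^sup>2)
    \<le> cube_expectation n (\<lambda>x. sqrt ((g x)\<^sup>2 + (h x)\<^sup>2))"
proof -
  have eq: "(\<Sum>x\<in>A. Complex (g x) (h x)) = Complex (sum g A) (sum h A)" for A
    by (simp add: complex_eq_iff)
  have "sqrt ((cube_expectation n g)\<^sup>2 + (cube_expectation n h)\<^sup>2)
      = sqrt ((sum g (cube n))\<^sup>2 + (sum h (cube n))\<^sup>2) / 2 ^ n"
    by (simp add: cube_expectation_eq_sum power_divide add_divide_distrib[symmetric] real_sqrt_divide)
  also have "\<dots> = cmod (\<Sum>x\<in>cube n. Complex (g x) (h x)) / 2 ^ n"
    by (simp add: eq complex_norm)
  also have "\<dots> \<le> (\<Sum>x\<in>cube n. cmod (Complex (g x) (h x))) / 2 ^ n"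
    by (intro divide_right_mono norm_sum) simp
  also have "\<dots> = cube_expectation n (\<lambda>x. sqrt ((g x)\<^sup>2 + (h x)\<^sup>2))"
    by (simp add: cube_expectation_eq_sum complex_norm)
  finally show ?thesis .
qed

text \<open>An edge at \<open>x(Suc n := b)\<close> either stays in the half-cube, where it belongs
  to the restriction of \<open>f\<close>, or is the single edge crossing to the other half.\<close>

lemma sensitivity_Suc:
  "sensitivity (Suc n) f (x(Suc n := b)) =
    sensitivity n (\<lambda>x. f (x(Suc n := b))) x + of_bool (f (x(Suc n := \<not> b)) \<noteq> f (x(Suc n := b)))"
proof -
  let ?S = "{i \<in> {1..n}. f ((flip i x)(Suc n := b)) \<noteq> f (x(Suc n := b))}"
  have swap: "flip i (x(Suc n := b)) = (flip i x)(Suc n := b)" if "i \<in> {1..n}" for i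
    using that by (auto simp: flip_def fun_eq_iff)
  have last: "flip (Suc n) (x(Suc n := b)) = x(Suc n := \<not> b)"
    by (simp add: flip_def)
  have "{i \<in> {1..Suc n}. f (flip i (x(Suc n := b))) \<noteq> f (x(Suc n := b))} =
      ?S \<union> (if f (x(Suc n := \<not> b)) \<noteq> f (x(Suc n := b)) then {Suc n} else {})"
    using swap last by (auto simp: le_Suc_eq)
  then show ?thesis
    by (auto simp: sensitivity_def card_insert_if)
qed

text \<open>The induction step on one half: Minkowski is applied to the root of the restricted
  sensitivity paired with the jump \<open>?d\<close> of \<open>f\<close> across the last coordinate,
  whose mean is \<open>p True - p False\<close>.\<close>

lemma cube_expectation_sqrt_sensitivity_Suc:
  fixes f :: "(nat \<Rightarrow> bool) \<Rightarrow> bool" and n :: nat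
  defines "p \<equiv> \<lambda>b. cube_expectation n (\<lambda>x. of_bool (f (x(Suc n := b))))"
  assumes IH: "sqrt (profile_sq (p b))
    \<le> cube_expectation n (\<lambda>x. sqrt (real (sensitivity n (\<lambda>x. f (x(Suc n := b))) x)))"
  shows "sqrt (profile_sq (p b) + (p True - p False)\<^sup>2)
    \<le> cube_expectation n (\<lambda>x. sqrt (real (sensitivity (Suc n) f (x(Suc n := b)))))"
proof -
  let ?s = "\<lambda>x. sqrt (real (sensitivity n (\<lambda>x. f (x(Suc n := b))) x))"
  let ?d = "\<lambda>x. of_bool (f (x(Suc n := True))) - of_bool (f (x(Suc n := False))) :: real"
  have p: "0 \<le> profile_sq (p b)"
    unfolding p_def by (intro profile_sq_nonneg cube_expectation_of_bool_bounds)
  have "p True - p False = cube_expectation n ?d"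
    by (simp add: p_def cube_expectation_eq_sum sum_subtractf diff_divide_distrib)
  moreover have "profile_sq (p b) \<le> (cube_expectation n ?s)\<^sup>2"
    using power_mono[OF IH, of 2] p by simp
  ultimately have "sqrt (profile_sq (p b) + (p True - p False)\<^sup>2)
      \<le> sqrt ((cube_expectation n ?s)\<^sup>2 + (cube_expectation n ?d)\<^sup>2)"
    by simp
  also have "\<dots> \<le> cube_expectation n (\<lambda>x. sqrt ((?s x)\<^sup>2 + (?d x)\<^sup>2))"
    by (rule cube_expectation_minkowski)
  \<comment> \<open>The jump \<open>?d x\<close> is -1, 0 or 1, so its square is the indicator in
    \<open>sensitivity_Suc\<close>.\<close>
  also have "(\<lambda>x. sqrt ((?s x)\<^sup>2 + (?d x)\<^sup>2))
      = (\<lambda>x. sqrt (real (sensitivity (Suc n) f (x(Suc n := b)))))"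
    by (cases b) (auto simp: sensitivity_Suc fun_eq_iff)
  finally show ?thesis .
qed

section \<open>Induction on the dimension and the final constant\<close>

lemma sqrt_sensitivity_ge_profile:
  "sqrt (profile_sq (cube_expectation n (\<lambda>x. of_bool (f x))))
    \<le> cube_expectation n (\<lambda>x. sqrt (real (sensitivity n f x)))"
proof (induction n arbitrary: f)
  case 0
  have "cube 0 = {\<lambda>_. undefined}" by (simp add: cube_def)
  \<comment> \<open>On a single point the mean of \<open>f\<close> is 0 or 1, where the profile
    vanishes.\<close>
  then show ?case
    by (cases "f (\<lambda>_. undefined)")
      (simp_all add: cube_expectation_eq_sum profile_sq_def profile_var_def sensitivity_def)
next
  case (Suc n)
  define p where "p b = cube_expectation n (\<lambda>x. of_bool (f (x(Suc n := b))))" for b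
  have "2 * sqrt (profile_sq ((p True + p False) / 2))
      \<le> sqrt (profile_sq (p True) + (p True - p False)\<^sup>2) + sqrt (profile_sq (p False) + (p True - p False)\<^sup>2)"
    unfolding p_def by (intro two_point cube_expectation_of_bool_bounds)
  also have "\<dots> \<le> cube_expectation n (\<lambda>x. sqrt (real (sensitivity (Suc n) f (x(Suc n := True)))))
      + cube_expectation n (\<lambda>x. sqrt (real (sensitivity (Suc n) f (x(Suc n := False)))))"
    unfolding p_def by (intro add_mono cube_expectation_sqrt_sensitivity_Suc Suc.IH)
  finally show ?case
    by (simp add: cube_expectation_Suc p_def)
qed

lemma cube_variance_eq:
  "cube_variance n f =
    cube_expectation n (\<lambda>x. of_bool (f x)) * (1 - cube_expectation n (\<lambda>x. of_bool (f x)))"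
proof -
  have "(\<lambda>x. (of_bool (f x))\<^sup>2) = (\<lambda>x. of_bool (f x) :: real)"
    by (auto simp: fun_eq_iff)
  then show ?thesis
    by (simp add: cube_variance_def power2_eq_square algebra_simps)
qed

theorem theorem1p2:
  shows "\<exists>c::real. c > 0 \<and>
    (\<forall>(n::nat) (f :: (nat \<Rightarrow> bool) \<Rightarrow> bool). n > 0 \<longrightarrow> \<not> f constant_on cube n \<longrightarrow>
      cube_expectation n (\<lambda>x. sqrt (real (sensitivity n f x)))
        \<ge> c * cube_variance n f * sqrt (log 2 (1 / cube_variance n f)))"
proof (intro exI[of _ "sqrt (ln 2)"] conjI allI impI)
  fix n :: nat and f :: "(nat \<Rightarrow> bool) \<Rightarrow> bool"
  define p where "p = cube_expectation n (\<lambda>x. of_bool (f x))"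
  define v where "v = cube_variance n f"
  have vp: "v = p * (1 - p)" by (simp add: v_def p_def cube_variance_eq)
  have p: "0 \<le> p" "p \<le> 1" using cube_expectation_of_bool_bounds by (simp_all add: p_def)
  then have "0 \<le> v" by (simp add: vp)
  \<comment> \<open>The constant \<open>sqrt (ln 2)\<close> converts the base-2 logarithm to
    \<open>ln\<close>; the shift by 2 in the profile then only enlarges the radicand.\<close>
  have "sqrt (ln 2) * v * sqrt (log 2 (1 / v)) = v * sqrt (ln (1 / v))"
    by (simp add: log_def real_sqrt_divide)
  also have "\<dots> \<le> v * sqrt (2 - ln v)"
    using \<open>0 \<le> v\<close> by (intro mult_left_mono) (auto simp: ln_div)
  also have "\<dots> = sqrt (profile_sq p)"
    using \<open>0 \<le> v\<close> by (simp add: profile_sq_def profile_var_def vp real_sqrt_mult)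
  also have "\<dots> \<le> cube_expectation n (\<lambda>x. sqrt (real (sensitivity n f x)))"
    unfolding p_def by (rule sqrt_sensitivity_ge_profile)
  finally show "cube_expectation n (\<lambda>x. sqrt (real (sensitivity n f x)))
      \<ge> sqrt (ln 2) * cube_variance n f * sqrt (log 2 (1 / cube_variance n f))"
    by (simp add: v_def)
qed simp

end
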